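(* Let $\Omega\subseteq\mathcal{W}$ be any fixed class of kernels. The algebraic subsets of $\Omega$ are closed under finite unions and arbitrary intersections. Moreover, $\varnothing$ and $\Omega$ are algebraic. Hence the complements of algebraic subsets define a topology on $\Omega$.
   Context: A kernel is a bounded symmetric measurable function $W:[0,1]^2\to\mathbb{R}$; $\mathcal{W}$ denotes the set of all kernels. For a kernel $W$ and a finite loopless multigraph $F=(V,E)$, the homomorphism density is $t(F,W)=\int_{[0,1]^V}\prod_{ij\in E}W(x_i,x_j)\prod_{i\in V}dx_i$ (product over edges with multiplicity). $\mathcal{A}$ is the complex vector space of quantum graphs, i.e. finite formal $\mathbb{C}$-linear combinations of unlabeled finite loopless multigraphs (basis: isomorphism classes, including the empty graph $K_0$). The density extends linearly: $t(\sum_i\alpha_iF_i,W)=\sum_i\alpha_i t(F_i,W)$. For $Q\subseteq\mathcal{A}$, let $\mathrm{V}_\Omega(Q)=\{W\in\Omega: t(g,W)=0\text{ for every }g\in Q\}$. A subset $Y\subseteq\Omega$ is called algebraic if $Y=\mathrm{V}_\Omega(Q)$ for some $Q\subseteq\mathcal{A}$. *)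

theory Defs
  imports "HOL-Probability.Probability" "HOL-Library.Poly_Mapping"
begin

text \<open>
  Extensionality makes the values outside the unit square irrelevant, so that the elements of the
  type are genuinely functions on the square. Measurability is Lebesgue measurability.
\<close>

typedef kernel =
  "{W :: real \<times> real \<Rightarrow> real.
      W \<in> extensional ({0..1} \<times> {0..1}) \<and>
      W \<in> borel_measurable (lebesgue_on ({0..1} \<times> {0..1})) \<and>
      bounded (W ` ({0..1} \<times> {0..1})) \<and>
      (\<forall>x\<in>{0..1}. \<forall>y\<in>{0..1}. W (x, y) = W (y, x))}"
proof -
  have "restrict (\<lambda>_. 0 :: real) ({0..1} \<times> {0..1 :: real}) \<in> borel_measurable (lebesgue_on ({0..1} \<times> {0..1}))"
    by (subst measurable_cong[where g = "\<lambda>_. 0"]) auto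
  then show ?thesis
    by (intro exI[of _ "restrict (\<lambda>_. 0) ({0..1} \<times> {0..1})"]) (auto intro!: boundedI[of _ 0])
qed

setup_lifting type_definition_kernel

text \<open>
  A finite multigraph is, up to isomorphism, a pair of a finite set of natural numbers and a
  multiset of two-element subsets of it.
\<close>

definition multigraph :: "nat set \<times> nat set multiset \<Rightarrow> bool" where
  "multigraph G \<longleftrightarrow> finite (fst G) \<and> (\<forall>e\<in>#snd G. e \<subseteq> fst G \<and> card e = 2)"

definition multigraph_iso ::
    "nat set \<times> nat set multiset \<Rightarrow> nat set \<times> nat set multiset \<Rightarrow> bool" where
  "multigraph_iso G H \<longleftrightarrow> multigraph G \<and> multigraph H \<and>
     (\<exists>f. bij_betw f (fst G) (fst H) \<and> snd H = image_mset (\<lambda>e. f ` e) (snd G))"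

lemma multigraph_iso_refl: "multigraph G \<Longrightarrow> multigraph_iso G G"
  unfolding multigraph_iso_def by (auto intro!: exI[of _ id])

lemma multigraph_iso_sym:
  assumes "multigraph_iso G H"
  shows "multigraph_iso H G"
proof -
  obtain f where f: "bij_betw f (fst G) (fst H)" "snd H = image_mset (\<lambda>e. f ` e) (snd G)"
    and G: "multigraph G" and H: "multigraph H"
    using assms by (auto simp: multigraph_iso_def)
  let ?g = "the_inv_into (fst G) f"
  have "image_mset (\<lambda>e. ?g ` e) (snd H) = image_mset (\<lambda>e. ?g ` f ` e) (snd G)"
    by (simp add: f(2) multiset.map_comp o_def)
  also have "\<dots> = image_mset (\<lambda>e. e) (snd G)"
  proof (rule image_mset_cong)
    fix e assume "e \<in># snd G"
    then have "e \<subseteq> fst G" using G by (auto simp: multigraph_def)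
    then show "?g ` f ` e = e"
      using f(1) by (force simp: image_image bij_betw_def the_inv_into_f_f)
  qed
  finally show ?thesis
    using bij_betw_the_inv_into[OF f(1)] G H by (auto simp: multigraph_iso_def intro!: exI[of _ ?g])
qed

lemma multigraph_iso_trans:
  assumes "multigraph_iso G H" "multigraph_iso H K"
  shows "multigraph_iso G K"
proof -
  obtain f g where "bij_betw f (fst G) (fst H)" "snd H = image_mset (\<lambda>e. f ` e) (snd G)"
    "bij_betw g (fst H) (fst K)" "snd K = image_mset (\<lambda>e. g ` e) (snd H)"
    using assms by (auto simp: multigraph_iso_def)
  then have "bij_betw (g \<circ> f) (fst G) (fst K) \<and> snd K = image_mset (\<lambda>e. (g \<circ> f) ` e) (snd G)"
    using bij_betw_trans by (auto simp: multiset.map_comp image_image o_def)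
  then show ?thesis using assms unfolding multigraph_iso_def by blast
qed

quotient_type unlabeled_multigraph = "nat set \<times> nat set multiset" / partial: multigraph_iso
proof (rule part_equivpI)
  show "\<exists>G. multigraph_iso G G"
    by (rule exI[of _ "({}, {#})"], rule multigraph_iso_refl) (simp add: multigraph_def)
  show "symp multigraph_iso" by (rule sympI) (rule multigraph_iso_sym)
  show "transp multigraph_iso" by (rule transpI) (rule multigraph_iso_trans)
qed

abbreviation unit_lborel :: "real measure" where
  "unit_lborel \<equiv> restrict_space lborel {0..1}"

text \<open>Lebesgue measure on the cube, that is, the completion of the product measure.\<close>

definition cube_measure :: "nat set \<Rightarrow> (nat \<Rightarrow> real) measure" where
  "cube_measure V = completion (Pi\<^sub>M V (\<lambda>_. unit_lborel))"

text \<open>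
  For a kernel the order in which the two ends of an edge are passed to \<open>W\<close> is immaterial; \<open>Min\<close>
  and \<open>Max\<close> merely pick one.
\<close>

definition edge_product :: "nat set multiset \<Rightarrow> (real \<times> real \<Rightarrow> real) \<Rightarrow> (nat \<Rightarrow> real) \<Rightarrow> real" where
  "edge_product E W x = (\<Prod>e\<in>#E. W (x (Min e), x (Max e)))"

definition labeled_density :: "nat set \<times> nat set multiset \<Rightarrow> (real \<times> real \<Rightarrow> real) \<Rightarrow> real" where
  "labeled_density G W = (\<integral>x. edge_product (snd G) W x \<partial>cube_measure (fst G))"

lemma prob_space_unit_lborel: "prob_space unit_lborel"
  by (rule prob_spaceI) (simp add: emeasure_restrict_space)

lemma unit_lborel_pair:
  "unit_lborel \<Otimes>\<^sub>M unit_lborel = restrict_space lborel ({0..1} \<times> {0..1 :: real})"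
proof (rule pair_measure_eqI)
  show "sigma_finite_measure unit_lborel" "sigma_finite_measure unit_lborel"
    using prob_space_unit_lborel prob_space_imp_sigma_finite by auto
  show "sets (unit_lborel \<Otimes>\<^sub>M unit_lborel) = sets (restrict_space lborel ({0..1} \<times> {0..1 :: real}))"
  proof (rule antisym)
    show "sets (unit_lborel \<Otimes>\<^sub>M unit_lborel) \<subseteq> sets (restrict_space lborel ({0..1} \<times> {0..1 :: real}))"
    proof (rule sets_pair_in_sets)
      fix A B assume "A \<in> sets unit_lborel" "B \<in> sets unit_lborel"
      then have "A \<times> B \<in> sets borel" "A \<times> B = ({0..1} \<times> {0..1}) \<inter> (A \<times> B)"
        by (auto simp: sets_restrict_space intro!: borel_Times)
      then show "A \<times> B \<in> sets (restrict_space lborel ({0..1} \<times> {0..1}))"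
        unfolding sets_restrict_space sets_lborel by blast
    qed
    have "(\<lambda>x. x) \<in> unit_lborel \<rightarrow>\<^sub>M borel" by (intro measurable_restrict_space1) simp
    then have m: "(\<lambda>x. (fst x, snd x)) \<in> unit_lborel \<Otimes>\<^sub>M unit_lborel \<rightarrow>\<^sub>M borel"
      by (intro borel_measurable_Pair)
        (rule measurable_compose[OF measurable_fst], simp, rule measurable_compose[OF measurable_snd], simp)
    show "sets (restrict_space lborel ({0..1} \<times> {0..1 :: real})) \<subseteq> sets (unit_lborel \<Otimes>\<^sub>M unit_lborel)"
      using measurable_sets[OF m]
      by (auto simp: sets_restrict_space space_pair_measure space_restrict_space Int_commute)
  qed
  fix A B assume "A \<in> sets unit_lborel" "B \<in> sets unit_lborel"
  then have AB: "A \<in> sets lborel" "B \<in> sets lborel" "A \<subseteq> {0..1}" "B \<subseteq> {0..1}"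
    by (auto simp: sets_restrict_space)
  have "emeasure lborel (A \<times> B) = emeasure lborel A * emeasure lborel B"
    using AB lborel.emeasure_pair_measure_Times[of A lborel B] by (simp add: lborel_prod)
  then show "emeasure unit_lborel A * emeasure unit_lborel B =
      emeasure (restrict_space lborel ({0..1} \<times> {0..1})) (A \<times> B)"
    using AB by (simp add: emeasure_restrict_space[OF _ Sigma_mono] emeasure_restrict_space borel_Times)
qed

lemma distr_unit_cube_pair:
  fixes V :: "nat set"
  assumes "finite V" "i \<in> V" "j \<in> V" "i \<noteq> j"
  shows "distr (Pi\<^sub>M V (\<lambda>_. unit_lborel)) (unit_lborel \<Otimes>\<^sub>M unit_lborel) (\<lambda>x. (x i, x j)) =
    unit_lborel \<Otimes>\<^sub>M unit_lborel"
proof -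
  let ?P = "Pi\<^sub>M V (\<lambda>_. unit_lborel)"
  interpret U: prob_space unit_lborel by (rule prob_space_unit_lborel)
  interpret product_sigma_finite "\<lambda>_::nat. unit_lborel"
    by unfold_locales
  show ?thesis
  proof (rule pair_measure_eqI[symmetric])
    show "sigma_finite_measure unit_lborel" "sigma_finite_measure unit_lborel"
      by unfold_locales
    fix A B assume AB: "A \<in> sets unit_lborel" "B \<in> sets unit_lborel"
    define C where "C k = (if k = i then A else if k = j then B else space unit_lborel)" for k
    have "(\<lambda>x. (x i, x j)) -` (A \<times> B) \<inter> space ?P = Pi\<^sub>E V C"
    proof (rule set_eqI)
      fix x :: "nat \<Rightarrow> real"
      have "A \<subseteq> space unit_lborel" "B \<subseteq> space unit_lborel"
        using AB[THEN sets.sets_into_space] .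
      moreover have "(\<forall>k\<in>V. x k \<in> C k) \<longleftrightarrow>
          x i \<in> A \<and> x j \<in> B \<and> (\<forall>k\<in>V. k \<noteq> i \<longrightarrow> k \<noteq> j \<longrightarrow> x k \<in> space unit_lborel)"
        unfolding C_def using assms by metis
      moreover have "(\<forall>k\<in>V. x k \<in> space unit_lborel) \<longleftrightarrow> x i \<in> space unit_lborel \<and>
          x j \<in> space unit_lborel \<and> (\<forall>k\<in>V. k \<noteq> i \<longrightarrow> k \<noteq> j \<longrightarrow> x k \<in> space unit_lborel)"
        using assms by metis
      ultimately show "x \<in> (\<lambda>x. (x i, x j)) -` (A \<times> B) \<inter> space ?P \<longleftrightarrow> x \<in> Pi\<^sub>E V C"
        unfolding space_PiM PiE_iff vimage_def Int_iff mem_Collect_eq mem_Times_iff fst_conv snd_conv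
        by blast
    qed
    moreover have "emeasure ?P (Pi\<^sub>E V C) = (\<Prod>k\<in>V. emeasure unit_lborel (C k))"
      by (rule emeasure_PiM) (use sets.top[of unit_lborel] in \<open>simp_all add: C_def assms AB\<close>)
    moreover have "(\<Prod>k\<in>V. emeasure unit_lborel (C k)) = (\<Prod>k\<in>{i, j}. emeasure unit_lborel (C k))"
      by (rule prod.mono_neutral_right) (use U.emeasure_space_1 in \<open>auto simp: C_def assms\<close>)
    moreover have "(\<lambda>x. (x i, x j)) \<in> ?P \<rightarrow>\<^sub>M unit_lborel \<Otimes>\<^sub>M unit_lborel"
      using assms by (intro measurable_Pair measurable_component_singleton)
    ultimately show "emeasure unit_lborel A * emeasure unit_lborel B =
        emeasure (distr ?P (unit_lborel \<Otimes>\<^sub>M unit_lborel) (\<lambda>x. (x i, x j))) (A \<times> B)"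
      using assms AB by (simp add: emeasure_distr C_def)
  qed simp
qed

lemma measurable_cube_pair:
  assumes "finite V" "i \<in> V" "j \<in> V" "i \<noteq> j"
  shows "(\<lambda>x. (x i, x j)) \<in> cube_measure V \<rightarrow>\<^sub>M lebesgue_on ({0..1} \<times> {0..1})"
proof -
  let ?P = "Pi\<^sub>M V (\<lambda>_. unit_lborel)" and ?U = "unit_lborel \<Otimes>\<^sub>M unit_lborel"
  have m: "(\<lambda>x. (x i, x j)) \<in> ?P \<rightarrow>\<^sub>M ?U"
    using assms by (intro measurable_Pair measurable_component_singleton)
  have "(\<lambda>x. (x i, x j)) \<in> completion ?P \<rightarrow>\<^sub>M completion ?U"
    by (rule completion.measurable_completion2)
       (use m assms in \<open>simp_all add: measurable_completion distr_completion distr_unit_cube_pair\<close>)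
  moreover have "(\<lambda>x. x) \<in> completion ?U \<rightarrow>\<^sub>M lebesgue_on ({0..1} \<times> {0..1})"
  proof (rule measurableI)
    fix A :: "(real \<times> real) set" assume "A \<in> sets (lebesgue_on ({0..1} \<times> {0..1}))"
    then obtain B where B: "B \<in> sets lebesgue" "A = ({0..1} \<times> {0..1}) \<inter> B"
      by (auto simp: sets_restrict_space)
    have "{0..1 :: real} \<times> {0..1 :: real} \<in> sets lebesgue"
      by (intro sets_completionI_sets) (simp add: borel_closed closed_Times)
    with B have "A \<in> sets lebesgue" by (metis sets.Int)
    then obtain S N N' where SN: "A = S \<union> N" "N \<subseteq> N'" "N' \<in> null_sets lborel" "S \<in> sets lborel"
      by (auto elim: sets_completionE)
    let ?Q = "{0..1 :: real} \<times> {0..1 :: real}"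
    have Q: "?Q \<in> sets lborel" by (simp add: borel_Times)
    have "A \<in> sets (completion (restrict_space lborel ?Q))"
    proof (rule sets_completionI[of A S N "N' \<inter> ?Q"])
      show "N \<subseteq> N' \<inter> ?Q" "A = S \<union> N" using SN B by auto
      show "N' \<inter> ?Q \<in> null_sets (restrict_space lborel ?Q)"
        using SN(3) Q by (subst null_sets_restrict_space) (simp_all add: null_set_Int2)
      have "S = S \<inter> ?Q" using SN(1) B(2) by auto
      then show "S \<in> sets (restrict_space lborel ?Q)"
        using SN(4) by (auto simp: sets_restrict_space)
    qed
    then show "(\<lambda>x. x) -` A \<inter> space (completion ?U) \<in> sets (completion ?U)"
      using B(2) by (simp add: unit_lborel_pair space_restrict_space Int_absorb2 vimage_def)
  qed (auto simp: unit_lborel_pair space_restrict_space)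
  ultimately show ?thesis unfolding cube_measure_def by (rule measurable_compose)
qed

lemma card_2_Min_Max:
  fixes e :: "nat set"
  assumes "card e = 2"
  shows "Min e \<noteq> Max e" "e = {Min e, Max e}"
proof -
  obtain a b where "e = {a, b}" "a \<noteq> b"
    using assms by (auto simp: card_2_iff)
  then show "Min e \<noteq> Max e" "e = {Min e, Max e}"
    by (simp_all add: min_def max_def insert_commute)
qed

lemma borel_measurable_edge_product:
  assumes "multigraph (V, E)" "W \<in> borel_measurable (lebesgue_on ({0..1} \<times> {0..1}))"
  shows "edge_product E W \<in> borel_measurable (cube_measure V)"
proof -
  have "(\<lambda>x. \<Prod>e\<in>#D. W (x (Min e), x (Max e))) \<in> borel_measurable (cube_measure V)"
    if "D \<subseteq># E" for D
    using that
  proof (induction D)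
    case (add e D)
    have "e \<in># E" using mset_subset_eqD[OF add.prems] by simp
    then have "e \<subseteq> V" "card e = 2" "finite V" using assms(1) by (auto simp: multigraph_def)
    moreover note card_2_Min_Max[OF \<open>card e = 2\<close>]
    ultimately have "(\<lambda>x. W (x (Min e), x (Max e))) \<in> borel_measurable (cube_measure V)"
      by (intro measurable_compose[OF measurable_cube_pair assms(2)]) auto
    moreover have "D \<subseteq># E"
      using add.prems by (rule subset_mset.order_trans[rotated]) simp
    ultimately show ?case using add.IH by simp
  qed simp
  then show ?thesis by (simp add: edge_product_def[abs_def])
qed

lemma labeled_density_iso:
  assumes "multigraph_iso G H"
    and W: "W \<in> borel_measurable (lebesgue_on ({0..1} \<times> {0..1}))"
    and sym: "\<forall>x\<in>{0..1}. \<forall>y\<in>{0..1}. W (x, y) = W (y, x)"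
  shows "labeled_density G W = labeled_density H W"
proof -
  obtain V E V' E' where GH: "G = (V, E)" "H = (V', E')" by (cases G, cases H)
  obtain f where f: "bij_betw f V V'" "E' = image_mset (\<lambda>e. f ` e) E"
    and G: "multigraph (V, E)" and H: "multigraph (V', E')"
    using assms(1) by (auto simp: multigraph_iso_def GH)
  let ?P = "Pi\<^sub>M V (\<lambda>_. unit_lborel)" and ?P' = "Pi\<^sub>M V' (\<lambda>_. unit_lborel)"
  define h where "h x = (\<lambda>n\<in>V. x (f n))" for x :: "nat \<Rightarrow> real"
  have fV: "inj_on f V" "f \<in> V \<rightarrow> V'" using f(1) by (auto simp: bij_betw_def)
  have d: "distr ?P' ?P h = ?P"
    using distr_PiM_reindex[OF prob_space_unit_lborel fV] by (simp add: h_def[abs_def])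
  have h: "h \<in> ?P' \<rightarrow>\<^sub>M ?P"
    unfolding h_def using fV by (intro measurable_restrict measurable_component_singleton) auto
  have d': "distr (completion ?P') ?P h = ?P" using h d by (simp add: distr_completion)
  have hc: "h \<in> completion ?P' \<rightarrow>\<^sub>M completion ?P"
    by (rule completion.measurable_completion2) (use h d' in \<open>simp_all add: measurable_completion\<close>)
  have dc: "distr (completion ?P') (completion ?P) h = completion ?P"
    using completion.completion_distr_eq[of h ?P' ?P] h d' by (simp add: measurable_completion)
  have eq: "edge_product E W (h x) = edge_product E' W x" if x: "x \<in> space ?P'" for x
  proof -
    have "W (h x (Min e), h x (Max e)) = W (x (Min (f ` e)), x (Max (f ` e)))" if "e \<in># E" for e
    proof -
      have e: "e \<subseteq> V" "card e = 2" using G that by (auto simp: multigraph_def)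
      note m = card_2_Min_Max[OF e(2)]
      define a b where "a = Min e" and "b = Max e"
      have ab: "a \<in> V" "b \<in> V" "e = {a, b}" using m e(1) unfolding a_def b_def by auto
      have "f a \<in> V'" "f b \<in> V'" using ab fV by auto
      then have "x (f a) \<in> {0..1}" "x (f b) \<in> {0..1}"
        using x by (auto simp: space_PiM PiE_iff space_restrict_space)
      then have "W (x (f a), x (f b)) = W (x (f b), x (f a))" using sym by blast
      moreover have "h x a = x (f a)" "h x b = x (f b)" using ab by (simp_all add: h_def)
      ultimately show ?thesis
        unfolding a_def[symmetric] b_def[symmetric] unfolding ab(3)
        by (simp add: min_def max_def)
    qed
    then show ?thesis
      by (simp add: edge_product_def f(2) multiset.map_comp o_def cong: image_mset_cong)
  qed
  have "labeled_density G W = (\<integral>x. edge_product E W x \<partial>distr (completion ?P') (completion ?P) h)"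
    by (simp add: labeled_density_def GH cube_measure_def dc)
  also have "\<dots> = (\<integral>x. edge_product E W (h x) \<partial>completion ?P')"
    using borel_measurable_edge_product[OF G W] hc
    by (intro integral_distr) (simp_all add: cube_measure_def)
  also have "\<dots> = (\<integral>x. edge_product E' W x \<partial>completion ?P')"
    by (rule Bochner_Integration.integral_cong) (simp_all add: eq)
  finally show ?thesis by (simp add: labeled_density_def GH cube_measure_def)
qed

lift_definition hom_density :: "unlabeled_multigraph \<Rightarrow> kernel \<Rightarrow> real" is labeled_density
  using labeled_density_iso by blast

type_synonym quantum_graph = "unlabeled_multigraph \<Rightarrow>\<^sub>0 complex"

definition quantum_density :: "quantum_graph \<Rightarrow> kernel \<Rightarrow> complex" where
  "quantum_density g W = (\<Sum>F\<in>Poly_Mapping.keys g. Poly_Mapping.lookup g F * of_real (hom_density F W))"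

definition zero_set :: "kernel set \<Rightarrow> quantum_graph set \<Rightarrow> kernel set" where
  "zero_set \<Omega> Q = {W \<in> \<Omega>. \<forall>g\<in>Q. quantum_density g W = 0}"

definition algebraic :: "kernel set \<Rightarrow> kernel set \<Rightarrow> bool" where
  "algebraic \<Omega> Y \<longleftrightarrow> (\<exists>Q. Y = zero_set \<Omega> Q)"

end

theory Submission
  imports Defs
begin

text \<open>
  Homomorphism densities are multiplicative under disjoint union of graphs, so products of densities
  of quantum graphs are again densities of quantum graphs. Hence the union of the zero sets of \<open>P\<close>
  and \<open>Q\<close> is the zero set of all products of an element of \<open>P\<close> and an element of \<open>Q\<close>, as for the
  Zariski topology. The graph without vertices has density \<open>1\<close>, which makes the empty set algebraic.
\<close>

section \<open>Densities of disjoint unions\<close>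

lemma multigraph_Un:
  assumes "multigraph (V, E)" "multigraph (V', E')"
  shows "multigraph (V \<union> V', E + E')"
  using assms by (auto simp: multigraph_def)

text \<open>Translating all vertices past a bound for \<open>A\<close> preserves the isomorphism
  type. Two representatives must be moved apart before their union is a disjoint union.\<close>

lemma multigraph_disjoint_copy:
  assumes "multigraph (V, E)" "finite (A :: nat set)"
  obtains V' E' where "multigraph (V', E')" "multigraph_iso (V, E) (V', E')" "A \<inter> V' = {}"
proof -
  obtain n where n: "A \<subseteq> {..<n}"
    using assms(2) finite_nat_iff_bounded by blast
  let ?f = "(+) n"
  have inj: "inj_on ?f B" for B by simp
  have m: "multigraph (?f ` V, image_mset (\<lambda>e. ?f ` e) E)"
    using assms(1) by (auto simp: multigraph_def card_image[OF inj])
  moreover have "multigraph_iso (V, E) (?f ` V, image_mset (\<lambda>e. ?f ` e) E)"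
    unfolding multigraph_iso_def using m assms(1) inj
    by (auto simp: bij_betw_def intro!: exI[of _ ?f])
  moreover have "A \<inter> ?f ` V = {}" using n by auto
  ultimately show thesis by (rule that)
qed

lemma edge_product_union: "edge_product (E + E') W x = edge_product E W x * edge_product E' W x"
  by (simp add: edge_product_def)

text \<open>Both ends of an edge lie in \<open>V\<close>, so the edge product never reads a
  coordinate outside \<open>V\<close>.\<close>

lemma edge_product_restrict:
  assumes "multigraph (V, E)"
  shows "edge_product E W (restrict x V) = edge_product E W x"
proof -
  have "W (restrict x V (Min e), restrict x V (Max e)) = W (x (Min e), x (Max e))" if "e \<in># E" for e
  proof -
    have "e \<subseteq> V" "card e = 2" using assms that by (auto simp: multigraph_def)
    then have "Min e \<in> V" "Max e \<in> V" using card_2_Min_Max[of e] by auto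
    then show ?thesis by simp
  qed
  then show ?thesis by (simp add: edge_product_def cong: image_mset_cong)
qed

lemma prob_space_cube: "prob_space (Pi\<^sub>M V (\<lambda>_. unit_lborel))"
  by (intro prob_space_PiM prob_space_unit_lborel)

text \<open>A bounded measurable function on a finite measure space is integrable; the bound has one
  factor \<open>B\<close> per edge.\<close>

lemma integrable_edge_product:
  assumes "multigraph (V, E)"
    and W: "W \<in> borel_measurable (lebesgue_on ({0..1} \<times> {0..1}))"
    and bdd: "bounded (W ` ({0..1} \<times> {0..1}))"
  shows "integrable (cube_measure V) (edge_product E W)"
proof -
  interpret prob_space "Pi\<^sub>M V (\<lambda>_. unit_lborel)" by (rule prob_space_cube)
  have fin: "finite_measure (cube_measure V)"
    by (rule finite_measureI) (simp add: cube_measure_def emeasure_completion emeasure_space_1)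
  obtain B where B: "\<And>u. u \<in> {0..1} \<times> {0..1} \<Longrightarrow> norm (W u) \<le> B"
    using bdd by (auto simp: bounded_iff)
  have bound: "norm (edge_product E W x) \<le> B ^ size E" if "x \<in> space (cube_measure V)" for x
  proof -
    \<comment> \<open>Inducting over submultisets of the fixed \<open>E\<close> keeps every edge of
      \<open>D\<close> inside \<open>V\<close>.\<close>
    have "norm (edge_product D W x) \<le> B ^ size D" if "D \<subseteq># E" for D
      using that
    proof (induction D)
      case empty
      then show ?case by (simp add: edge_product_def)
    next
      case (add e D)
      have "e \<in># E" using mset_subset_eqD[OF add.prems] by simp
      then have e: "e \<subseteq> V" "card e = 2" using assms(1) by (auto simp: multigraph_def)
      then have "Min e \<in> V" "Max e \<in> V" using card_2_Min_Max[of e] by auto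
      then have "(x (Min e), x (Max e)) \<in> {0..1} \<times> {0..1}"
        using \<open>x \<in> space _\<close>
        by (auto simp: cube_measure_def space_PiM PiE_iff space_restrict_space)
      then have "norm (W (x (Min e), x (Max e))) \<le> B" by (rule B)
      moreover have "D \<subseteq># E"
        using add.prems by (rule subset_mset.order_trans[rotated]) simp
      ultimately show ?case
        using add.IH by (auto simp: edge_product_def abs_mult intro!: mult_mono)
    qed
    then show ?thesis by simp
  qed
  show ?thesis
    by (rule finite_measure.integrable_const_bound[OF fin])
      (use bound borel_measurable_edge_product[OF assms(1) W] in auto)
qed

text \<open>The integrand splits into a factor in the \<open>V\<close>-coordinates and one in the
  \<open>V'\<close>-coordinates, so Fubini separates the integrals once both factors are replaced by
  almost everywhere equal functions measurable for the uncompleted products.\<close>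

lemma labeled_density_disjoint_Un:
  assumes G: "multigraph (V, E)" and H: "multigraph (V', E')" and disj: "V \<inter> V' = {}"
    and W: "W \<in> borel_measurable (lebesgue_on ({0..1} \<times> {0..1}))"
    and bdd: "bounded (W ` ({0..1} \<times> {0..1}))"
  shows "labeled_density (V \<union> V', E + E') W = labeled_density (V, E) W * labeled_density (V', E') W"
proof -
  let ?P = "\<lambda>I. Pi\<^sub>M I (\<lambda>_::nat. unit_lborel)"
  interpret U: prob_space unit_lborel by (rule prob_space_unit_lborel)
  interpret product_prob_space "\<lambda>_::nat. unit_lborel" by unfold_locales
  have fin: "finite V" "finite V'" using G H by (auto simp: multigraph_def)
  txt \<open>Fubini is available for the product measures but not for their completions.\<close>
  have ex: "\<exists>f. f \<in> borel_measurable (?P I) \<and> (AE x in ?P I. edge_product D W x = f x)"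
    if "multigraph (I, D)" for I D
    using completion_ex_borel_measurable_real[OF
        borel_measurable_edge_product[OF that W, unfolded cube_measure_def]] by auto
  \<comment> \<open>Any such representative computes the density over the uncompleted product and
    inherits integrability from the edge product.\<close>
  have dens: "labeled_density (I, D) W = (\<integral>x. f x \<partial>?P I)" "integrable (?P I) f"
    if "multigraph (I, D)" and f: "f \<in> borel_measurable (?P I)"
      and ae: "AE x in ?P I. edge_product D W x = f x" for I D f
  proof -
    have m: "edge_product D W \<in> borel_measurable (completion (?P I))"
      using borel_measurable_edge_product[OF that(1) W] by (simp add: cube_measure_def)
    have f': "f \<in> borel_measurable (completion (?P I))" using f by (rule measurable_completion)
    have ae': "AE x in completion (?P I). edge_product D W x = f x"
      using ae by (rule AE_completion)
    show "labeled_density (I, D) W = (\<integral>x. f x \<partial>?P I)"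
      using integral_cong_AE[OF m f' ae'] f
      by (simp add: labeled_density_def cube_measure_def integral_completion)
    have "integrable (completion (?P I)) f"
      using integrable_cong_AE[OF m f' ae'] integrable_edge_product[OF that(1) W bdd]
      by (simp add: cube_measure_def)
    then show "integrable (?P I) f" using f by (simp add: integrable_completion)
  qed
  obtain f f' where f: "f \<in> borel_measurable (?P V)" "AE x in ?P V. edge_product E W x = f x"
    and f': "f' \<in> borel_measurable (?P V')" "AE x in ?P V'. edge_product E' W x = f' x"
    using ex[OF G] ex[OF H] by blast
  define h where "h x = f (restrict x V) * f' (restrict x V')" for x
  have r: "(\<lambda>x. restrict x V) \<in> ?P (V \<union> V') \<rightarrow>\<^sub>M ?P V"
    "(\<lambda>x. restrict x V') \<in> ?P (V \<union> V') \<rightarrow>\<^sub>M ?P V'"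
    by (auto intro: measurable_restrict_subset)
  have h: "h \<in> borel_measurable (?P (V \<union> V'))"
    unfolding h_def using measurable_compose[OF r(1) f(1)] measurable_compose[OF r(2) f'(1)] by simp
  \<comment> \<open>The marginals of the product measure are the smaller products, so almost
    everywhere statements pull back along the restrictions.\<close>
  have dr: "distr (?P (V \<union> V')) (?P V) (\<lambda>x. restrict x V) = ?P V"
    "distr (?P (V \<union> V')) (?P V') (\<lambda>x. restrict x V') = ?P V'"
    using distr_restrict[of V "V \<union> V'"] distr_restrict[of V' "V \<union> V'"] fin by simp_all
  have "AE x in ?P (V \<union> V'). edge_product E W (restrict x V) = f (restrict x V)"
    by (rule AE_distrD[OF r(1)]) (use f(2) in \<open>simp only: dr\<close>)
  moreover have "AE x in ?P (V \<union> V'). edge_product E' W (restrict x V') = f' (restrict x V')"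
    by (rule AE_distrD[OF r(2)]) (use f'(2) in \<open>simp only: dr\<close>)
  ultimately have ae: "AE x in ?P (V \<union> V'). edge_product (E + E') W x = h x"
    by eventually_elim
      (simp add: edge_product_union h_def edge_product_restrict[OF G] edge_product_restrict[OF H])
  note d = dens[OF multigraph_Un[OF G H] h ae]
  have "labeled_density (V \<union> V', E + E') W = (\<integral>x. (\<integral>y. h (merge V V' (x, y)) \<partial>?P V') \<partial>?P V)"
    using d product_integral_fold[OF disj fin d(2)] by simp
  \<comment> \<open>Points of the product spaces are extensional, so restricting the merged point
    gives back exactly \<open>x\<close> and \<open>y\<close>.\<close>
  also have "\<dots> = (\<integral>x. (\<integral>y. f x * f' y \<partial>?P V') \<partial>?P V)"
    using disj
    by (intro Bochner_Integration.integral_cong refl)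
      (auto simp: h_def space_PiM PiE_restrict)
  also have "\<dots> = (\<integral>x. f x \<partial>?P V) * (\<integral>y. f' y \<partial>?P V')"
    by simp
  also have "\<dots> = labeled_density (V, E) W * labeled_density (V', E') W"
    using dens(1)[OF G f] dens(1)[OF H f'] by simp
  finally show ?thesis .
qed

section \<open>Densities of isomorphism classes\<close>

lemma hom_density_abs:
  "multigraph G \<Longrightarrow> hom_density (abs_unlabeled_multigraph G) W = labeled_density G (Rep_kernel W)"
   \<comment> \<open>The quotient is partial: evaluation at \<open>G\<close> requires
     \<open>multigraph_iso G G\<close>, which holds for multigraphs.\<close>
   using hom_density.abs_eq[of G "Rep_kernel W"] Rep_kernel[of W]
  by (simp add: multigraph_iso_refl eq_onp_same_args Rep_kernel_inverse)

lemma unlabeled_multigraph_cases: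
  obtains V E where "F = abs_unlabeled_multigraph (V, E)" "multigraph (V, E)"
  by (induction F rule: unlabeled_multigraph.abs_induct) (force simp: multigraph_iso_def)

text \<open>The witness is the class of a disjoint union of representatives. Stating mere existence
  avoids defining a product on classes and proving it well defined.\<close>

lemma hom_density_mult:
  "\<exists>H. \<forall>W. hom_density H W = hom_density F W * hom_density G W"
proof -
  obtain V E where F: "F = abs_unlabeled_multigraph (V, E)" "multigraph (V, E)"
    by (rule unlabeled_multigraph_cases)
  obtain I D where G: "G = abs_unlabeled_multigraph (I, D)" "multigraph (I, D)"
    by (rule unlabeled_multigraph_cases)
  obtain V' E' where H: "multigraph (V', E')" "multigraph_iso (I, D) (V', E')" "V \<inter> V' = {}"
    using multigraph_disjoint_copy[OF G(2), of V] F(2) by (auto simp: multigraph_def)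
  have "hom_density (abs_unlabeled_multigraph (V \<union> V', E + E')) W = hom_density F W * hom_density G W"
    for W
    using Rep_kernel[of W] F H(1,3) labeled_density_iso[OF H(2), of "Rep_kernel W"]
    by (simp add: G hom_density_abs multigraph_Un labeled_density_disjoint_Un)
  then show ?thesis by blast
qed

text \<open>For the empty graph, the empty product 1 is integrated against a probability
  measure.\<close>

lemma hom_density_one: "\<exists>F. \<forall>W. hom_density F W = 1"
proof -
  interpret prob_space "Pi\<^sub>M ({} :: nat set) (\<lambda>_. unit_lborel)" by (rule prob_space_cube)
  have "multigraph ({}, {#})" by (simp add: multigraph_def)
  moreover have "labeled_density ({}, {#}) W = 1" for W
    by (simp add: labeled_density_def edge_product_def cube_measure_def integral_completion prob_space)
  ultimately show ?thesis using hom_density_abs by metis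
qed

section \<open>Quantum graphs and algebraic sets\<close>

text \<open>Indices outside the support contribute zero. This puts several quantum graphs over one
  index set, as additivity requires.\<close>

lemma quantum_density_superset:
  assumes "finite S" "Poly_Mapping.keys g \<subseteq> S"
  shows "quantum_density g W = (\<Sum>F\<in>S. Poly_Mapping.lookup g F * of_real (hom_density F W))"
  unfolding quantum_density_def using assms
  by (intro sum.mono_neutral_left) (auto simp: in_keys_iff)

lemma quantum_density_zero: "quantum_density 0 W = 0"
  by (simp add: quantum_density_def)

lemma quantum_density_add: "quantum_density (g + h) W = quantum_density g W + quantum_density h W"
proof -
  let ?S = "Poly_Mapping.keys g \<union> Poly_Mapping.keys h"
  have "Poly_Mapping.keys (g + h) \<subseteq> ?S" by (rule Poly_Mapping.keys_add)
  then show ?thesis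
    by (simp add: quantum_density_superset[of ?S] lookup_add distrib_right sum.distrib)
qed

lemma quantum_density_sum: "quantum_density (\<Sum>i\<in>I. g i) W = (\<Sum>i\<in>I. quantum_density (g i) W)"
  by (induction I rule: infinite_finite_induct) (auto simp: quantum_density_zero quantum_density_add)

lemma quantum_density_single:
  "quantum_density (Poly_Mapping.single F c) W = c * of_real (hom_density F W)"
  by (simp add: quantum_density_def)

lemma quantum_density_mult:
  "\<exists>p. \<forall>W. quantum_density p W = quantum_density g W * quantum_density h W"
proof -
  obtain m where m: "\<And>F G W. hom_density (m F G) W = hom_density F W * hom_density G W"
    using hom_density_mult by metis
  \<comment> \<open>Bilinear extension of the chosen \<open>m\<close>. Since \<open>m\<close> may
    send several pairs to one class, a sum of monomials is used, which adds up their
    coefficients.\<close>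
  let ?p = "\<Sum>F\<in>Poly_Mapping.keys g. \<Sum>G\<in>Poly_Mapping.keys h.
    Poly_Mapping.single (m F G) (Poly_Mapping.lookup g F * Poly_Mapping.lookup h G)"
  have "quantum_density ?p W = quantum_density g W * quantum_density h W" for W
    unfolding quantum_density_sum quantum_density_single m
    by (simp add: quantum_density_def sum_product mult_ac)
  then show ?thesis by blast
qed

section \<open>Algebraic sets and their topology\<close>

lemma algebraic_empty: "algebraic \<Omega> {}"
proof -
  obtain F where "\<And>W. hom_density F W = 1" using hom_density_one by blast
  then have "zero_set \<Omega> {Poly_Mapping.single F 1} = {}"
    by (simp add: zero_set_def quantum_density_single)
  then show ?thesis unfolding algebraic_def by blast
qed

lemma algebraic_Un:
  assumes "algebraic \<Omega> X" "algebraic \<Omega> Y"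
  shows "algebraic \<Omega> (X \<union> Y)"
proof -
  obtain P Q where PQ: "X = zero_set \<Omega> P" "Y = zero_set \<Omega> Q"
    using assms by (auto simp: algebraic_def)
  obtain m where m: "\<And>g h W. quantum_density (m g h) W = quantum_density g W * quantum_density h W"
    using quantum_density_mult by metis
  have "X \<union> Y = zero_set \<Omega> {m g h | g h. g \<in> P \<and> h \<in> Q}"
    \<comment> \<open>If some \<open>g\<close> in \<open>P\<close> does not vanish at
      \<open>W\<close>, the vanishing of all \<open>m g h\<close> forces every \<open>h\<close> in
      \<open>Q\<close> to vanish there.\<close>
    unfolding PQ zero_set_def by (auto simp: m) (metis m mult_eq_0_iff)
  then show ?thesis unfolding algebraic_def by blast
qed

lemma algebraic_Union:
  assumes "finite \<Y>" "\<And>Y. Y \<in> \<Y> \<Longrightarrow> algebraic \<Omega> Y"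
  shows "algebraic \<Omega> (\<Union>\<Y>)"
  using assms by (induction \<Y>) (auto simp: algebraic_empty algebraic_Un)

text \<open>The union of the defining sets of quantum graphs defines the intersection. Intersecting
  with \<Omega> gives the empty family the value \<Omega> instead of the whole type.\<close>

lemma algebraic_Inter:
  assumes "\<And>Y. Y \<in> \<Y> \<Longrightarrow> algebraic \<Omega> Y"
  shows "algebraic \<Omega> (\<Omega> \<inter> \<Inter>\<Y>)"
proof -
  obtain Q where Q: "\<And>Y. Y \<in> \<Y> \<Longrightarrow> Y = zero_set \<Omega> (Q Y)"
    using assms unfolding algebraic_def by metis
  have "W \<in> \<Omega> \<inter> \<Inter>\<Y> \<longleftrightarrow> W \<in> zero_set \<Omega> (\<Union>(Q ` \<Y>))" for W
  proof -
    have "(\<forall>Y\<in>\<Y>. W \<in> Y) \<longleftrightarrow> (\<forall>Y\<in>\<Y>. W \<in> zero_set \<Omega> (Q Y))" using Q by blast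
    then show ?thesis by (auto simp: zero_set_def)
  qed
  then show ?thesis unfolding algebraic_def by blast
qed

lemma algebraic_subset: "algebraic \<Omega> Y \<Longrightarrow> Y \<subseteq> \<Omega>"
  by (auto simp: algebraic_def zero_set_def)

lemma algebraic_self: "algebraic \<Omega> \<Omega>"
  using algebraic_Inter[of "{}" \<Omega>] by simp

text \<open>By De Morgan, binary unions and arbitrary intersections of algebraic sets become the two
  closure conditions for open sets.\<close>

lemma istopology_algebraic_complements:
  "istopology (\<lambda>U. \<exists>Y. algebraic \<Omega> Y \<and> U = \<Omega> - Y)"
  unfolding istopology_def
proof (intro conjI allI impI)
  fix S T assume "\<exists>Y. algebraic \<Omega> Y \<and> S = \<Omega> - Y" "\<exists>Y. algebraic \<Omega> Y \<and> T = \<Omega> - Y"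
  then obtain X Y where "algebraic \<Omega> X" "S = \<Omega> - X" "algebraic \<Omega> Y" "T = \<Omega> - Y" by blast
  then show "\<exists>Y. algebraic \<Omega> Y \<and> S \<inter> T = \<Omega> - Y"
    by (intro exI[of _ "X \<union> Y"]) (auto simp: algebraic_Un)
next
  fix \<U> assume *: "\<forall>U\<in>\<U>. \<exists>Y. algebraic \<Omega> Y \<and> U = \<Omega> - Y"
  \<comment> \<open>Algebraic sets lie in \<Omega>, so taking the complement twice recovers the
    algebraic set behind \<open>U\<close>.\<close>
  have alg: "algebraic \<Omega> (\<Omega> - U)" "U \<subseteq> \<Omega>" if "U \<in> \<U>" for U
    using * that algebraic_subset by (auto simp: double_diff)
  have "algebraic \<Omega> (\<Omega> \<inter> \<Inter>((-) \<Omega> ` \<U>))"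
    by (rule algebraic_Inter) (use alg in auto)
  moreover have "\<Union>\<U> = \<Omega> - (\<Omega> \<inter> \<Inter>((-) \<Omega> ` \<U>))" using alg(2) by auto
  ultimately show "\<exists>Y. algebraic \<Omega> Y \<and> \<Union>\<U> = \<Omega> - Y" by blast
qed

theorem proposition5p4:
  fixes \<Omega> :: "kernel set"
  shows "(\<forall>\<Y>. finite \<Y> \<and> (\<forall>Y\<in>\<Y>. algebraic \<Omega> Y) \<longrightarrow> algebraic \<Omega> (\<Union>\<Y>)) \<and>
    (\<forall>\<Y>. (\<forall>Y\<in>\<Y>. algebraic \<Omega> Y) \<longrightarrow> algebraic \<Omega> (\<Omega> \<inter> \<Inter>\<Y>)) \<and>
    algebraic \<Omega> {} \<and> algebraic \<Omega> \<Omega> \<and>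
    (\<exists>T. topspace T = \<Omega> \<and> (\<forall>U. openin T U \<longleftrightarrow> (\<exists>Y. algebraic \<Omega> Y \<and> U = \<Omega> - Y)))"
proof (intro conjI)
  define T where "T = topology (\<lambda>U. \<exists>Y. algebraic \<Omega> Y \<and> U = \<Omega> - Y)"
  have T: "openin T U \<longleftrightarrow> (\<exists>Y. algebraic \<Omega> Y \<and> U = \<Omega> - Y)" for U
    unfolding T_def by (simp add: topology_inverse'[OF istopology_algebraic_complements])
  \<comment> \<open>\<Omega> is the complement of the empty algebraic set, and every open set lies
    in \<Omega>, so their union \<open>topspace T\<close> is \<Omega>.\<close>
  have "openin T \<Omega>" unfolding T using algebraic_empty by blast
  then have "topspace T = \<Omega>"
    unfolding topspace_def T by blast
  with T show "\<exists>T. topspace T = \<Omega> \<and> (\<forall>U. openin T U \<longleftrightarrow> (\<exists>Y. algebraic \<Omega> Y \<and> U = \<Omega> - Y))"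
    by blast
qed (auto simp: algebraic_empty algebraic_self intro: algebraic_Union algebraic_Inter)

end
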